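(* Let $(Y,\le)$ be a partially ordered set and let $T:Y\to Y$ be antimonotone. Suppose that $T^2=T\circ T$ has fixed points $m$ and $M$ such that $m\le\mu\le M$ for every fixed point $\mu$ of $T^2$. Then the following conditions are equivalent, and each of them suffices for $T$ to have exactly one fixed point: (a) $m=M$; (b) $T^2$ has a unique fixed point; (c) any fixed point of $T^2$ is a fixed point of $T$; (d) the fixed point sets of $T$ and $T^2$ coincide; (e) either $m$ or $M$ is a fixed point of $T$. If, in addition, $(Y,\le)$ is a complete lattice, then all these conditions are equivalent to the following one: (f) $A\le B$ for any $A,B\in Y$ which satisfy $T^2(B)\le B$ and $A\le T^2(A)$.
   Context: A mapping $T:Y\to Y$ on a partially ordered set $(Y,\le)$ is antimonotone if $A\le B$ implies $T(B)\le T(A)$ for all $A,B\in Y$. A partially ordered set $(Y,\le)$ with $Y$ nonempty is a complete lattice if every subset of $Y$ has a least upper bound and a greatest lower bound in $Y$. In (e), "either ... or" is inclusive: at least one of $m$, $M$ is a fixed point of $T$. *)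

theory Defs
  imports Main "HOL-Library.Lub_Glb"
begin

definition fixed_points :: "('a \<Rightarrow> 'a) \<Rightarrow> 'a set" where
  "fixed_points f = {x. f x = x}"

text \<open>
  Completeness is stated as a property of a type that is only known to be partially ordered,
  so that it can be an additional hypothesis on a given order (the class \<open>complete_lattice\<close>
  carries its own operations). Sets may be empty, so the type has a least and a greatest element.
\<close>

definition complete_lattice_order :: "'a::order itself \<Rightarrow> bool" where
  "complete_lattice_order _ \<longleftrightarrow>
     (\<forall>S::'a set. (\<exists>x. isLub UNIV S x) \<and> (\<exists>x. isGlb UNIV S x))"

end

theory Submission
  imports Defs
begin

text \<open>
  Write \<open>S = T \<circ> T\<close>, which is monotone and commutes with \<open>T\<close>, so that \<open>T\<close> maps fixed points of
  \<open>S\<close> to fixed points of \<open>S\<close>. The key fact (\<open>antimono_swaps_extremal_fixed_points\<close>) is that \<open>T\<close>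
  exchanges the extremal fixed points \<open>m\<close> and \<open>M\<close> of \<open>S\<close>: as \<open>T M\<close> is fixed by \<open>S\<close>, we have
  \<open>m \<le> T M\<close>, hence \<open>M = T (T M) \<le> T m\<close>, while \<open>T m \<le> M\<close> because \<open>T m\<close> is fixed by \<open>S\<close> too. Thus
  if either \<open>m\<close> or \<open>M\<close> is fixed by \<open>T\<close>, then \<open>m = M\<close>; conversely, if \<open>m = M\<close>, then this point is the
  only fixed point of \<open>S\<close> and also a fixed point of \<open>T\<close>. This gives the equivalence of the first
  five conditions, and the unique fixed point of \<open>T\<close>.

  In a complete lattice, the Knaster--Tarski argument shows that a point \<open>A\<close> with \<open>A \<le> S A\<close> lies
  below a fixed point of \<open>S\<close>, hence below \<open>M\<close>, and that a point \<open>B\<close> with \<open>S B \<le> B\<close> lies above \<open>m\<close>.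
  So \<open>m = M\<close> implies \<open>A \<le> B\<close>. Conversely, the choice \<open>A = M\<close>, \<open>B = m\<close> gives \<open>M \<le> m\<close>.
\<close>

text \<open>
  The two halves of the Knaster--Tarski theorem, for a type that need not belong to the class
  \<open>complete_lattice\<close>; each needs only one bound, and no lattice operations.
\<close>

lemma fixed_point_above_post_fixed_point:
  fixes S :: "'a::order \<Rightarrow> 'a"
  assumes "mono S" and lub: "isLub UNIV {y. y \<le> S y} x" and "A \<le> S A"
  shows "S x = x \<and> A \<le> x"
proof -
  have upper: "y \<le> x" if "y \<le> S y" for y
    using isLubD2[OF lub] that by simp
  have least: "x \<le> z" if "\<And>y. y \<le> S y \<Longrightarrow> y \<le> z" for z
    using lub that by (intro isLub_le_isUb[OF lub] isUbI setleI) auto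
  have "x \<le> S x"
  proof (rule least)
    fix y assume "y \<le> S y"
    also have "S y \<le> S x"
      using \<open>mono S\<close> upper[OF \<open>y \<le> S y\<close>] by (rule monoD)
    finally show "y \<le> S x" .
  qed
  moreover have "S x \<le> x"
    using upper monoD[OF \<open>mono S\<close> \<open>x \<le> S x\<close>] .
  ultimately show ?thesis
    using upper[OF \<open>A \<le> S A\<close>] by simp
qed

lemma fixed_point_below_pre_fixed_point:
  fixes S :: "'a::order \<Rightarrow> 'a"
  assumes "mono S" and glb: "isGlb UNIV {y. S y \<le> y} x" and "S B \<le> B"
  shows "S x = x \<and> x \<le> B"
proof -
  have lower: "x \<le> y" if "S y \<le> y" for y
    using glb that by (auto simp: isGlb_def greatestP_def isLb_def setge_def)
  have greatest: "z \<le> x" if "\<And>y. S y \<le> y \<Longrightarrow> z \<le> y" for z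
    using glb that by (auto simp: isGlb_def greatestP_def isLb_def setge_def setle_def)
  have "S x \<le> x"
  proof (rule greatest)
    fix y assume "S y \<le> y"
    have "S x \<le> S y"
      using \<open>mono S\<close> lower[OF \<open>S y \<le> y\<close>] by (rule monoD)
    also note \<open>S y \<le> y\<close>
    finally show "S x \<le> y" .
  qed
  moreover have "x \<le> S x"
    using lower monoD[OF \<open>mono S\<close> \<open>S x \<le> x\<close>] .
  ultimately show ?thesis
    using lower[OF \<open>S B \<le> B\<close>] by simp
qed

lemma antimono_swaps_extremal_fixed_points:
  fixes T :: "'a::order \<Rightarrow> 'a"
  assumes "antimono T"
    and m: "m \<in> fixed_points (T \<circ> T)" and M: "M \<in> fixed_points (T \<circ> T)"
    and between: "\<And>\<mu>. \<mu> \<in> fixed_points (T \<circ> T) \<Longrightarrow> m \<le> \<mu> \<and> \<mu> \<le> M"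
  shows "T m = M" and "T M = m"
proof -
  have "T m \<in> fixed_points (T \<circ> T)" and TM: "T M \<in> fixed_points (T \<circ> T)"
    using m M by (simp_all add: fixed_points_def)
  then have "T m \<le> M" and "m \<le> T M"
    using between by blast+
  moreover have "M \<le> T m"
    using antimonoD[OF \<open>antimono T\<close> \<open>m \<le> T M\<close>] M by (simp add: fixed_points_def)
  ultimately show "T m = M"
    by simp
  then show "T M = m"
    using m by (auto simp: fixed_points_def)
qed

theorem theorem6p1:
  fixes T :: "'a::order \<Rightarrow> 'a" and m M :: 'a
  assumes "antimono T"
    and "m \<in> fixed_points (T \<circ> T)"
    and "M \<in> fixed_points (T \<circ> T)"
    and "\<And>\<mu>. \<mu> \<in> fixed_points (T \<circ> T) \<Longrightarrow> m \<le> \<mu> \<and> \<mu> \<le> M"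
  shows "let a = (m = M);
             b = (\<exists>!x. x \<in> fixed_points (T \<circ> T));
             c = (\<forall>x. x \<in> fixed_points (T \<circ> T) \<longrightarrow> x \<in> fixed_points T);
             d = (fixed_points T = fixed_points (T \<circ> T));
             e = (m \<in> fixed_points T \<or> M \<in> fixed_points T);
             f = (\<forall>A B. (T \<circ> T) B \<le> B \<and> A \<le> (T \<circ> T) A \<longrightarrow> A \<le> B);
             unique_fixed_point = (\<exists>!x. x \<in> fixed_points T)
         in ((a \<longleftrightarrow> b) \<and> (a \<longleftrightarrow> c) \<and> (a \<longleftrightarrow> d) \<and> (a \<longleftrightarrow> e)) \<and>
            ((a \<longrightarrow> unique_fixed_point) \<and> (b \<longrightarrow> unique_fixed_point) \<and>
             (c \<longrightarrow> unique_fixed_point) \<and> (d \<longrightarrow> unique_fixed_point) \<and>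
             (e \<longrightarrow> unique_fixed_point)) \<and>
            (complete_lattice_order TYPE('a) \<longrightarrow>
              (a \<longleftrightarrow> f) \<and> (b \<longleftrightarrow> f) \<and> (c \<longleftrightarrow> f) \<and> (d \<longleftrightarrow> f) \<and> (e \<longleftrightarrow> f))"
proof -
  let ?F = "fixed_points (T \<circ> T)"
  let ?f = "\<forall>A B. (T \<circ> T) B \<le> B \<and> A \<le> (T \<circ> T) A \<longrightarrow> A \<le> B"
  have swap: "T m = M" "T M = m"
    by (rule antimono_swaps_extremal_fixed_points[OF assms(1-3)], rule assms(4), assumption)+
  have F_if_a: "?F = {m}" if "m = M"
  proof -
    have "x = m" if "x \<in> ?F" for x
      using assms(4)[OF that] \<open>m = M\<close> by (metis order.antisym)
    then show ?thesis
      using assms(2) by blast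
  qed
  have fp_sub: "fixed_points T \<subseteq> ?F"
    by (auto simp: fixed_points_def)
  have T_if_a: "fixed_points T = {m}" if "m = M"
  proof -
    have "m \<in> fixed_points T"
      using swap(1) that by (simp add: fixed_points_def)
    then show ?thesis
      using fp_sub F_if_a[OF that] by blast
  qed
  have ab: "m = M \<longleftrightarrow> (\<exists>!x. x \<in> ?F)"
    using F_if_a assms(2,3) by (metis singletonD)
  have ae: "m = M \<longleftrightarrow> m \<in> fixed_points T \<or> M \<in> fixed_points T"
    using swap by (simp add: fixed_points_def eq_commute)
  have ac: "m = M \<longleftrightarrow> (\<forall>x. x \<in> ?F \<longrightarrow> x \<in> fixed_points T)"
    using F_if_a T_if_a ae assms(2) by blast
  have ad: "m = M \<longleftrightarrow> fixed_points T = ?F"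
    using ac fp_sub by blast
  have unique: "\<exists>!x. x \<in> fixed_points T" if "m = M"
    using T_if_a[OF that] by simp
  have af: "m = M \<longleftrightarrow> ?f" if complete: "complete_lattice_order TYPE('a)"
  proof
    have "mono (T \<circ> T)"
      using \<open>antimono T\<close> by (simp add: monotone_on_def)
    assume "m = M"
    show ?f
    proof (intro allI impI, elim conjE)
      fix A B
      assume B: "(T \<circ> T) B \<le> B" and A: "A \<le> (T \<circ> T) A"
      obtain x y where "isLub UNIV {y. y \<le> (T \<circ> T) y} x"
        and "isGlb UNIV {y. (T \<circ> T) y \<le> y} y"
        using complete unfolding complete_lattice_order_def by blast
      then have x: "x \<in> ?F" "A \<le> x" and y: "y \<in> ?F" "y \<le> B"
        using fixed_point_above_post_fixed_point[OF \<open>mono (T \<circ> T)\<close> _ A]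
          fixed_point_below_pre_fixed_point[OF \<open>mono (T \<circ> T)\<close> _ B]
        unfolding fixed_points_def by blast+
      have "x = y"
        using x(1) y(1) F_if_a[OF \<open>m = M\<close>] by simp
      then show "A \<le> B"
        using x(2) y(2) by simp
    qed
  next
    assume ?f
    then have "M \<le> m"
      using assms(2,3) by (simp add: fixed_points_def)
    then show "m = M"
      using assms(4)[OF assms(3)] by (metis order.antisym)
  qed
  show ?thesis
    unfolding Let_def ab[symmetric] ac[symmetric] ad[symmetric] ae[symmetric]
    using af unique by blast
qed

end
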